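(* Let $G$ be a self-similar group of automorphisms of the rooted binary tree $X^*$, $X=\{0,1\}$. Then $G$ is level transitive if and only if $G$ is infinite.
   Context: Let $X=\{0,1\}$ and let $X^*$ be the set of finite words over $X$, viewed as the rooted binary tree (root is the empty word, the children of $v$ are $v0,v1$; level $n$ is the set $X^n$ of words of length $n$). A group $G\le\mathrm{Aut}(X^* )$ is self-similar if for every $g\in G$ and $x\in X$ there exist $y\in X$ and $h\in G$ such that $g(xw)=yh(w)$ for all $w\in X^*$. The group $G$ is level transitive if it acts transitively on $X^n$ for every $n\ge 0$. *)

theory Defs
  imports "HOL-Algebra.Group"
begin

text \<open>
  The alphabet is \<^typ>\<open>bool\<close>, with \<^const>\<open>False\<close> for the letter 0 and \<^const>\<open>True\<close> for the letter 1.
\<close>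

type_synonym word = "bool list"

definition adjacent :: "word \<Rightarrow> word \<Rightarrow> bool" where
  "adjacent v w \<longleftrightarrow> (\<exists>x. w = v @ [x] \<or> v = w @ [x])"

definition tree_automorphism :: "(word \<Rightarrow> word) \<Rightarrow> bool" where
  "tree_automorphism g \<longleftrightarrow>
     bij g \<and> g [] = [] \<and> (\<forall>v w. adjacent (g v) (g w) \<longleftrightarrow> adjacent v w)"

definition tree_Aut :: "(word \<Rightarrow> word) monoid" where
  "tree_Aut = \<lparr>carrier = Collect tree_automorphism, mult = (\<circ>), one = id\<rparr>"

definition self_similar :: "(word \<Rightarrow> word) set \<Rightarrow> bool" where
  "self_similar G \<longleftrightarrow> (\<forall>g\<in>G. \<forall>x. \<exists>y. \<exists>h\<in>G. \<forall>w. g (x # w) = y # h w)"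

definition level_transitive :: "(word \<Rightarrow> word) set \<Rightarrow> bool" where
  "level_transitive G \<longleftrightarrow>
     (\<forall>n. \<forall>u v. length u = n \<and> length v = n \<longrightarrow> (\<exists>g\<in>G. g u = v))"

lemma tree_automorphism_inv:
  assumes "tree_automorphism g"
  shows "tree_automorphism (inv_into UNIV g)"
proof -
  have b: "bij g" and r: "g [] = []"
    and a: "\<And>v w. adjacent (g v) (g w) \<longleftrightarrow> adjacent v w"
    using assms by (auto simp: tree_automorphism_def)
  have s: "\<And>v. g (inv_into UNIV g v) = v"
    using b by (simp add: bij_is_surj surj_f_inv_f)
  have "inv_into UNIV g [] = []"
    using b r by (metis bij_inv_eq_iff)
  moreover have "adjacent (inv_into UNIV g v) (inv_into UNIV g w) \<longleftrightarrow> adjacent v w" for v w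
    using a[of "inv_into UNIV g v" "inv_into UNIV g w"] by (simp add: s)
  ultimately show ?thesis
    using b by (simp add: tree_automorphism_def bij_imp_bij_inv)
qed

lemma group_tree_Aut: "group tree_Aut"
proof (rule groupI)
  fix g assume "g \<in> carrier tree_Aut"
  then have t: "tree_automorphism g" by (simp add: tree_Aut_def)
  then have "inv_into UNIV g \<circ> g = id"
    by (simp add: tree_automorphism_def bij_is_inj)
  then show "\<exists>h\<in>carrier tree_Aut. h \<otimes>\<^bsub>tree_Aut\<^esub> g = \<one>\<^bsub>tree_Aut\<^esub>"
    using tree_automorphism_inv[OF t] by (auto simp: tree_Aut_def)
qed (auto simp: tree_Aut_def tree_automorphism_def bij_comp comp_assoc)

end

theory Submission imports Defs begin

text \<open>
  A transitive action on a level with \<open>2 ^ n\<close> words needs at least \<open>2 ^ n\<close> group elements.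
  Conversely, let \<open>G\<close> be infinite and transitive on level \<open>n\<close>. Two distinct elements of \<open>G\<close> agree
  on that level, so a nontrivial \<open>g\<close> in \<open>G\<close> fixes it pointwise. A shortest word moved by \<open>g\<close> has the
  form \<open>pvx\<close> with \<open>v\<close> of length \<open>n\<close> and \<open>x\<close> a letter. The section of \<open>g\<close> at \<open>p\<close> lies in \<open>G\<close> by
  self-similarity; it fixes \<open>v\<close> and swaps the two children of \<open>v\<close>. This swap extends transitivity to
  level \<open>n + 1\<close>.
\<close>

locale self_similar_group =
  fixes G :: "(word \<Rightarrow> word) set"
  assumes subgroup: "subgroup G tree_Aut"
    and self_similar: "self_similar G"
begin

lemma automorphism: "g \<in> G \<Longrightarrow> tree_automorphism g"
  using subgroup.subset[OF subgroup] by (auto simp: tree_Aut_def)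

lemma inj: "g \<in> G \<Longrightarrow> inj g"
  using automorphism by (auto simp: tree_automorphism_def bij_is_inj)

lemma map_Nil: "g \<in> G \<Longrightarrow> g [] = []"
  using automorphism by (auto simp: tree_automorphism_def)

lemma id_closed: "id \<in> G"
  using subgroup.one_closed[OF subgroup] by (simp add: tree_Aut_def)

lemma comp_closed: "g \<in> G \<Longrightarrow> h \<in> G \<Longrightarrow> g \<circ> h \<in> G"
  using subgroup.m_closed[OF subgroup] by (simp add: tree_Aut_def)

lemma left_inverse:
  assumes "g \<in> G"
  obtains k where "k \<in> G" "\<And>w. k (g w) = w"
proof
  let ?k = "m_inv tree_Aut g"
  show "?k \<in> G"
    using subgroup.m_inv_closed[OF subgroup assms] .
  have "g \<in> carrier tree_Aut"
    using subgroup.mem_carrier[OF subgroup assms] .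
  then have "?k \<circ> g = id"
    using group.l_inv[OF group_tree_Aut] by (simp add: tree_Aut_def)
  then show "?k (g w) = w" for w
    by (simp add: fun_eq_iff)
qed

lemma letter_section:
  assumes "g \<in> G"
  obtains y h where "h \<in> G" "\<And>w. g (x # w) = y # h w"
  using self_similar assms unfolding self_similar_def by meson

text \<open>Self-similarity allows induction on the word: the tail is moved by a section, which is
  another element of \<open>G\<close>, hence the generalisation over \<open>g\<close>.\<close>

lemma length_map: "g \<in> G \<Longrightarrow> length (g w) = length w"
proof (induction w arbitrary: g)
  case Nil
  then show ?case by (simp add: map_Nil)
next
  case (Cons x w)
  obtain y h where "h \<in> G" "\<And>w. g (x # w) = y # h w"
    using letter_section[OF Cons.prems] by metis
  then show ?case using Cons.IH by simp
qed

text \<open>Iterating letter sections along \<open>u\<close> gives a section at every vertex. This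
  later carries a swap found deep in the tree up to a prescribed level.\<close>

lemma word_section:
  assumes "g \<in> G"
  shows "\<exists>h\<in>G. \<forall>w. g (u @ w) = g u @ h w"
  using assms
proof (induction u arbitrary: g)
  case Nil
  then show ?case by (auto simp: map_Nil)
next
  case (Cons x u)
  obtain y h where h: "h \<in> G" "\<And>w. g (x # w) = y # h w"
    using letter_section[OF Cons.prems] by metis
  then show ?case using Cons.IH[OF h(1)] by simp
qed

text \<open>The section at \<open>u\<close> preserves length, so it sends a letter to a
  letter.\<close>

lemma map_child:
  assumes "g \<in> G"
  shows "\<exists>y. g (u @ [x]) = g u @ [y]"
proof -
  obtain h where h: "h \<in> G" "\<And>w. g (u @ w) = g u @ h w"
    using word_section[OF assms] by metis
  then have "length (h [x]) = 1"
    by (simp add: length_map)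
  then show ?thesis
    using h(2) by (auto simp: length_Suc_conv)
qed

text \<open>Pigeonhole: elements of \<open>G\<close> preserve length, so they have only finitely
  many restrictions to the words of length at most \<open>n\<close>. If \<open>g\<close> and
  \<open>h\<close> share one, the inverse of \<open>g\<close> composed with \<open>h\<close> is the
  required element.\<close>

lemma nontrivial_level_stabilizer:
  assumes "infinite G"
  obtains g where "g \<in> G" "g \<noteq> id" "\<And>w. length w \<le> n \<Longrightarrow> g w = w"
proof -
  define A where "A = {w :: word. length w \<le> n}"
  have "finite A"
    using finite_lists_length_le[of "UNIV :: bool set" n] by (simp add: A_def)
  moreover have "(\<lambda>g. restrict g A) ` G \<subseteq> A \<rightarrow>\<^sub>E A"
    by (intro image_subsetI, subst restrict_PiE_iff) (simp add: A_def length_map)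
  ultimately have "finite ((\<lambda>g. restrict g A) ` G)"
    using finite_PiE[of A "\<lambda>_. A"] finite_subset by blast
  then have "\<not> inj_on (\<lambda>g. restrict g A) G"
    using assms finite_imageD by blast
  then obtain g h where gh: "g \<in> G" "h \<in> G" "g \<noteq> h" "restrict g A = restrict h A"
    by (auto simp: inj_on_def)
  obtain k where k: "k \<in> G" "\<And>w. k (g w) = w"
    using left_inverse[OF gh(1)] by metis
  show thesis
  proof
    show "k \<circ> h \<in> G"
      using k(1) gh(2) by (rule comp_closed)
    show "k \<circ> h \<noteq> id"
    proof
      assume "k \<circ> h = id"
      then have "k (h w) = k (g w)" for w
        using k(2) by (simp add: fun_eq_iff)
      then show False
        using gh(3) inj[OF k(1)] by (auto simp: inj_def)
    qed
    show "(k \<circ> h) w = w" if "length w \<le> n" for w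
    proof -
      have "g w = h w"
        using fun_cong[OF gh(4), of w] that by (simp add: A_def)
      then show ?thesis using k(2)[of w] by simp
    qed
  qed
qed

lemma child_swap:
  assumes "infinite G"
  obtains h v where "h \<in> G" "length v = n" "\<And>x. h (v @ [x]) = v @ [\<not> x]"
proof -
  obtain g where g: "g \<in> G" "g \<noteq> id" "\<And>w. length w \<le> n \<Longrightarrow> g w = w"
    using nontrivial_level_stabilizer[OF assms] by metis
  \<comment> \<open>A moved word of least length; it is nonempty because the root is fixed.\<close>
  obtain w where w: "g w \<noteq> w" "\<And>w'. length w' < length w \<Longrightarrow> g w' = w'"
    using g(2) ex_has_least_nat[of "\<lambda>w. g w \<noteq> w" _ length]
    by (metis eq_id_iff linorder_not_less)
  then obtain u x where ux: "w = u @ [x]"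
    using map_Nil[OF g(1)] by (metis rev_exhaust)
  have "n \<le> length u"
    using g(3)[of w] w(1) ux by fastforce
  \<comment> \<open>The last \<open>n\<close> letters of \<open>u\<close> form \<open>v\<close>, so
    the section at \<open>p\<close> sees the parent of \<open>w\<close> on level
    \<open>n\<close>.\<close>
  define p v where "p = take (length u - n) u" and "v = drop (length u - n) u"
  have u: "u = p @ v" and len: "length v = n"
    using \<open>n \<le> length u\<close> by (simp_all add: p_def v_def)
  have fix_p: "g p = p" and fix_u: "g (p @ v) = p @ v"
    using w(2) ux u by simp_all
  obtain h where h: "h \<in> G" "\<And>w. g (p @ w) = g p @ h w"
    using word_section[OF g(1)] by metis
  have hv: "h v = v"
    using h(2)[of v] fix_p fix_u by simp
  have "\<exists>y. h (v @ [z]) = v @ [y]" for z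
    using map_child[OF h(1), of v z] hv by simp
  then obtain f where f: "\<And>z. h (v @ [z]) = v @ [f z]"
    by metis
  \<comment> \<open>Since \<open>g\<close> fixes \<open>p\<close> and moves \<open>w\<close>, the
    section \<open>h\<close> moves \<open>v @ [x]\<close>. An injective map on two letters that
    moves one of them is negation.\<close>
  have "f x \<noteq> x"
    using h(2)[of "v @ [x]"] f[of x] fix_p w(1) ux u by auto
  moreover have "f x \<noteq> f (\<not> x)"
    using inj_eq[OF inj[OF h(1)], of "v @ [x]" "v @ [\<not> x]"] f by auto
  ultimately have "f y = (\<not> y)" for y
    by (cases x; cases y) auto
  then have "h (v @ [y]) = v @ [\<not> y]" for y
    using f by simp
  then show thesis
    using that h(1) len by blast
qed

text \<open>The route from \<open>a\<close> to \<open>b\<close> passes through the vertex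
  \<open>v\<close> whose children are swapped by \<open>h\<close>. If \<open>l \<circ> k\<close>
  reaches the wrong child of \<open>b\<close>, inserting \<open>h\<close> at \<open>v\<close>
  corrects it.\<close>

lemma transitive_step:
  assumes "infinite G"
    and trans: "\<And>a b. length a = n \<Longrightarrow> length b = n \<Longrightarrow> \<exists>g\<in>G. g a = b"
    and "length a = n" "length b = n"
  shows "\<exists>g\<in>G. g (a @ [s]) = b @ [t]"
proof -
  obtain h v where h: "h \<in> G" "length v = n" "\<And>x. h (v @ [x]) = v @ [\<not> x]"
    using child_swap[OF assms(1)] by metis
  obtain k where k: "k \<in> G" "k a = v"
    using trans assms(3) h(2) by metis
  obtain l where l: "l \<in> G" "l v = b"
    using trans assms(4) h(2) by metis
  obtain s' where s': "k (a @ [s]) = v @ [s']"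
    using map_child[OF k(1)] k(2) by metis
  have "\<exists>y. l (v @ [z]) = b @ [y]" for z
    using map_child[OF l(1), of v z] l(2) by simp
  then obtain f where f: "\<And>z. l (v @ [z]) = b @ [f z]"
    by metis
  have "f s' \<noteq> f (\<not> s')"
    using inj_eq[OF inj[OF l(1)], of "v @ [s']" "v @ [\<not> s']"] f by auto
  then have "l (v @ [s']) = b @ [t] \<or> l (v @ [\<not> s']) = b @ [t]"
    using f by auto
  then have "(l \<circ> k) (a @ [s]) = b @ [t] \<or> (l \<circ> (h \<circ> k)) (a @ [s]) = b @ [t]"
    using s' h(3) by simp
  then show ?thesis
    using comp_closed h(1) k(1) l(1) by blast
qed

lemma infinite_imp_level_transitive:
  assumes "infinite G"
  shows "level_transitive G"
proof -
  have "length a = n \<Longrightarrow> length b = n \<Longrightarrow> \<exists>g\<in>G. g a = b" for n a b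
  proof (induction n arbitrary: a b)
    case 0
    then show ?case using id_closed by (auto intro!: bexI[of _ id])
  next
    case (Suc n)
    obtain a' s b' t where "a = a' @ [s]" "b = b' @ [t]"
      using Suc.prems by (metis length_0_conv nat.distinct(1) rev_exhaust)
    then show ?case
      using transitive_step[OF assms Suc.IH] Suc.prems by simp
  qed
  then show ?thesis
    by (simp add: level_transitive_def)
qed

end

lemma level_transitive_imp_infinite:
  assumes "level_transitive G"
  shows "infinite G"
proof
  assume fin: "finite G"
  \<comment> \<open>On this level the words outnumber the elements of \<open>G\<close>, so the orbit
    of a single word cannot fill it.\<close>
  define n where "n = card G"
  let ?X = "{w :: word. length w = n}"
  have "?X \<subseteq> (\<lambda>g. g (replicate n False)) ` G"
  proof
    fix w assume "w \<in> ?X"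
    then have "length (replicate n False) = n \<and> length w = n"
      by simp
    then obtain g where "g \<in> G" "g (replicate n False) = w"
      using assms unfolding level_transitive_def by blast
    then show "w \<in> (\<lambda>g. g (replicate n False)) ` G" by blast
  qed
  then have "card ?X \<le> n"
    unfolding n_def using surj_card_le[OF fin] by blast
  moreover have "card ?X = 2 ^ n"
    using card_lists_length_eq[of "UNIV :: bool set" n] by simp
  ultimately show False
    using less_exp[of n] by simp
qed

theorem proposition2:
  fixes G :: "(word \<Rightarrow> word) set"
  assumes "subgroup G tree_Aut"
    and "self_similar G"
  shows "level_transitive G \<longleftrightarrow> infinite G"
proof -
  interpret self_similar_group G
    using assms by (rule self_similar_group.intro)
  show ?thesis
    using level_transitive_imp_infinite infinite_imp_level_transitive by blast
qed

end
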